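(* Let $H$ be a finite group and let $G=H\times\langle a\rangle$ with $\langle a\rangle\cong\mathbb{Z}_2$. For every connected non-bipartite Cayley graph $\mathrm{Cay}(H,S)$ the following are equivalent: (1) $\mathrm{Cay}(H,S)$ is unstable; (2) there exists a Schurian S-ring $\mathcal{A}$ over $G$ such that $\underline{H}\in\mathcal{A}$, $\underline{Sa}\in\mathcal{A}$ and $\underline{\{a\}}\notin\mathcal{A}$, where $Sa=\{sa: s\in S\}$.
   Context: All groups and graphs are finite; graphs are simple. For a group $H$ and $S\subseteq H$ with $1_H\notin S$ and $S=S^{-1}$, the Cayley graph $\mathrm{Cay}(H,S)$ has vertex set $H$ and edges $\{x,sx\}$ for $x\in H$, $s\in S$. For a graph $\Gamma$, the direct product $\Gamma\times K_2$ has vertex set $V(\Gamma)\times\{0,1\}$ and edges $\{(u,0),(v,1)\}$ for $\{u,v\}\in E(\Gamma)$. $\Gamma$ is stable if $\mathrm{Aut}(\Gamma\times K_2)\cong\mathrm{Aut}(\Gamma)\times\mathbb{Z}_2$, and unstable otherwise. For $X\subseteq G$, $\underline{X}=\sum_{x\in X}x\in\mathbb{Z}G$. An S-ring (Schur ring) over $G$ is a subring $\mathcal{A}$ of the integer group ring $\mathbb{Z}G$ for which there is a partition $\mathcal{S}(\mathcal{A})$ of $G$ (the basic sets) such that $\{1_G\}\in\mathcal{S}(\mathcal{A})$, $X^{-1}\in\mathcal{S}(\mathcal{A})$ whenever $X\in\mathcal{S}(\mathcal{A})$, and $\mathcal{A}$ is the $\mathbb{Z}$-span of $\{\underline{X}:X\in\mathcal{S}(\mathcal{A})\}$.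 For $g\in G$ let $g_r$ be the permutation $x\mapsto xg$ and $G_r=\{g_r:g\in G\}$. An S-ring $\mathcal{A}$ over $G$ is Schurian if there is a permutation group $B\le\mathrm{Sym}(G)$ with $G_r\le B$ such that $\mathcal{A}$ is the $\mathbb{Z}$-span of $\{\underline{X}: X \text{ an orbit of the stabiliser } B_{1_G} \text{ on } G\}$. *)

theory Defs
  imports "HOL-Algebra.Elementary_Groups" "HOL-Algebra.Group_Action" "HOL-Algebra.Subrings"
    "HOL-Library.Disjoint_Sets" "HOL-Library.Indicator_Function"
    "Graph_Theory.Digraph_Component"
begin

text \<open>
  A finite simple graph is a \<^locale>\<open>pair_graph\<close>: the edge \<open>{u, v}\<close> is represented
  by the two arcs \<open>(u, v)\<close> and \<open>(v, u)\<close>.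
\<close>

definition cayley_graph :: "('a, 'm) monoid_scheme \<Rightarrow> 'a set \<Rightarrow> 'a pair_pre_digraph" where
  "cayley_graph H S =
     \<lparr>pverts = carrier H, parcs = {(x, s \<otimes>\<^bsub>H\<^esub> x) | x s. x \<in> carrier H \<and> s \<in> S}\<rparr>"

definition cayley_connection_set :: "('a, 'm) monoid_scheme \<Rightarrow> 'a set \<Rightarrow> bool" where
  "cayley_connection_set H S \<longleftrightarrow> S \<subseteq> carrier H \<and> \<one>\<^bsub>H\<^esub> \<notin> S \<and> S = set_inv\<^bsub>H\<^esub> S"

definition bipartite :: "'v pair_pre_digraph \<Rightarrow> bool" where
  "bipartite \<Gamma> \<longleftrightarrow> (\<exists>X Y. X \<union> Y = pverts \<Gamma> \<and> X \<inter> Y = {} \<and>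
     (\<forall>(u, v) \<in> parcs \<Gamma>. (u \<in> X \<and> v \<in> Y) \<or> (u \<in> Y \<and> v \<in> X)))"

definition times_K2 :: "'v pair_pre_digraph \<Rightarrow> ('v \<times> nat) pair_pre_digraph" where
  "times_K2 \<Gamma> =
     \<lparr>pverts = pverts \<Gamma> \<times> {0, 1},
      parcs = {((u, 0), (v, 1)) | u v. (u, v) \<in> parcs \<Gamma>} \<union>
              {((v, 1), (u, 0)) | u v. (u, v) \<in> parcs \<Gamma>}\<rparr>"

definition graph_automorphisms :: "'v pair_pre_digraph \<Rightarrow> ('v \<Rightarrow> 'v) set" where
  "graph_automorphisms \<Gamma> =
     {f \<in> Bij (pverts \<Gamma>).
        \<forall>u \<in> pverts \<Gamma>. \<forall>v \<in> pverts \<Gamma>. (u, v) \<in> parcs \<Gamma> \<longleftrightarrow> (f u, f v) \<in> parcs \<Gamma>}"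

definition Aut :: "'v pair_pre_digraph \<Rightarrow> ('v \<Rightarrow> 'v) monoid" where
  "Aut \<Gamma> = BijGroup (pverts \<Gamma>) \<lparr>carrier := graph_automorphisms \<Gamma>\<rparr>"

definition stable :: "'v pair_pre_digraph \<Rightarrow> bool" where
  "stable \<Gamma> \<longleftrightarrow> Aut (times_K2 \<Gamma>) \<cong> Aut \<Gamma> \<times>\<times> integer_mod_group 2"

text \<open>
  Elements of the integer group ring are the integer-valued functions vanishing
  outside the carrier. Meaningful for finite \<open>G\<close> only, as no finite support is imposed.
\<close>

definition int_group_ring :: "('a, 'm) monoid_scheme \<Rightarrow> ('a \<Rightarrow> int) ring" where
  "int_group_ring G =
     \<lparr>carrier = {f. \<forall>x. x \<notin> carrier G \<longrightarrow> f x = 0},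
      monoid.mult = (\<lambda>f g x. \<Sum>(y, z) \<in> {(y, z) \<in> carrier G \<times> carrier G. y \<otimes>\<^bsub>G\<^esub> z = x}. f y * g z),
      monoid.one = indicator {\<one>\<^bsub>G\<^esub>},
      ring.zero = (\<lambda>x. 0),
      ring.add = (\<lambda>f g x. f x + g x)\<rparr>"

text \<open>The group ring element written as an underlined \<open>X\<close>.\<close>

definition set_sum :: "'a set \<Rightarrow> 'a \<Rightarrow> int" where
  "set_sum X = indicator X"

definition int_span :: "('a \<Rightarrow> int) set \<Rightarrow> ('a \<Rightarrow> int) set" where
  "int_span F = {(\<lambda>x. \<Sum>f\<in>T. c f * f x) | c T. finite T \<and> T \<subseteq> F}"

definition S_ring :: "('a, 'm) monoid_scheme \<Rightarrow> ('a \<Rightarrow> int) set \<Rightarrow> bool" where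
  "S_ring G \<A> \<longleftrightarrow> subring \<A> (int_group_ring G) \<and>
     (\<exists>P. partition_on (carrier G) P \<and> {\<one>\<^bsub>G\<^esub>} \<in> P \<and> (\<forall>X \<in> P. set_inv\<^bsub>G\<^esub> X \<in> P) \<and>
          \<A> = int_span (set_sum ` P))"

definition right_translations :: "('a, 'm) monoid_scheme \<Rightarrow> ('a \<Rightarrow> 'a) set" where
  "right_translations G = {(\<lambda>x \<in> carrier G. x \<otimes>\<^bsub>G\<^esub> g) | g. g \<in> carrier G}"

text \<open>
  The orbits of a permutation group are those of the tautological action, in which
  every permutation acts as itself, i.e.\ via \<open>\<lambda>b. b\<close>.
\<close>

definition stabilizer_orbits :: "('a, 'm) monoid_scheme \<Rightarrow> ('a \<Rightarrow> 'a) set \<Rightarrow> 'a set set" where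
  "stabilizer_orbits G B =
     (let K = BijGroup (carrier G) \<lparr>carrier := B\<rparr>
      in orbits (K \<lparr>carrier := stabilizer K (\<lambda>b. b) \<one>\<^bsub>G\<^esub>\<rparr>) (carrier G) (\<lambda>b. b))"

definition Schurian :: "('a, 'm) monoid_scheme \<Rightarrow> ('a \<Rightarrow> int) set \<Rightarrow> bool" where
  "Schurian G \<A> \<longleftrightarrow>
     (\<exists>B. subgroup B (BijGroup (carrier G)) \<and> right_translations G \<subseteq> B \<and>
          \<A> = int_span (set_sum ` stabilizer_orbits G B))"

lemma pair_graph_cayley_graph:
  assumes "group H" "finite (carrier H)" "cayley_connection_set H S"
  shows "pair_graph (cayley_graph H S)"
proof -
  interpret group H by fact
  have S: "S \<subseteq> carrier H" "\<one>\<^bsub>H\<^esub> \<notin> S" and inv: "\<And>s. s \<in> S \<Longrightarrow> inv\<^bsub>H\<^esub> s \<in> S"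
    using assms(3) by (auto simp: cayley_connection_set_def SET_INV_def)
  have sub: "parcs (cayley_graph H S) \<subseteq> carrier H \<times> carrier H"
    using S by (auto simp: cayley_graph_def)
  show ?thesis
  proof
    show "finite (parcs (cayley_graph H S))"
      using sub assms(2) by (meson finite_SigmaI finite_subset)
    show "symmetric (with_proj (cayley_graph H S))"
    proof (simp add: symmetric_def, rule symI)
      fix x y assume "(x, y) \<in> parcs (cayley_graph H S)"
      then obtain s where s: "s \<in> S" "x \<in> carrier H" "y = s \<otimes>\<^bsub>H\<^esub> x"
        by (auto simp: cayley_graph_def)
      have sc: "s \<in> carrier H" using s S by auto
      have "x = inv\<^bsub>H\<^esub> s \<otimes>\<^bsub>H\<^esub> y" using s sc by (simp add: m_assoc[symmetric])
      then show "(y, x) \<in> parcs (cayley_graph H S)"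
        using s sc inv[OF s(1)] by (auto simp: cayley_graph_def)
    qed
  next
    fix e assume "e \<in> parcs (cayley_graph H S)"
    then obtain x s where s: "s \<in> S" "x \<in> carrier H" "e = (x, s \<otimes>\<^bsub>H\<^esub> x)"
      by (auto simp: cayley_graph_def)
    have sc: "s \<in> carrier H" using s S by auto
    show "fst e \<noteq> snd e" using s sc S(2) by (auto dest: sym)
  qed (use sub S assms(2) in \<open>auto simp: cayley_graph_def\<close>)
qed

lemma int_group_ring_mult:
  assumes "group G" "finite (carrier G)" "x \<in> carrier G"
  shows "(f \<otimes>\<^bsub>int_group_ring G\<^esub> g) x = (\<Sum>y\<in>carrier G. f y * g (inv\<^bsub>G\<^esub> y \<otimes>\<^bsub>G\<^esub> x))"
proof -
  interpret group G by fact
  have "(\<Sum>y\<in>carrier G. f y * g (inv\<^bsub>G\<^esub> y \<otimes>\<^bsub>G\<^esub> x)) =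
    (\<Sum>(y, z) \<in> {(y, z) \<in> carrier G \<times> carrier G. y \<otimes>\<^bsub>G\<^esub> z = x}. f y * g z)"
    by (rule sum.reindex_bij_witness[where j = "\<lambda>y. (y, inv\<^bsub>G\<^esub> y \<otimes>\<^bsub>G\<^esub> x)" and i = fst])
       (use assms(3) in \<open>auto simp: m_assoc[symmetric]\<close>)
  then show ?thesis by (simp add: int_group_ring_def)
qed

lemma int_group_ring_mult_outside:
  assumes "group G" "x \<notin> carrier G"
  shows "(f \<otimes>\<^bsub>int_group_ring G\<^esub> g) x = 0"
proof -
  interpret group G by fact
  have "{(y, z) \<in> carrier G \<times> carrier G. y \<otimes>\<^bsub>G\<^esub> z = x} = {}" using assms(2) by auto
  then show ?thesis unfolding int_group_ring_def monoid.simps by (simp only: sum.empty)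
qed

lemma ring_int_group_ring:
  assumes "group G" "finite (carrier G)"
  shows "ring (int_group_ring G)"
proof -
  interpret group G by fact
  let ?R = "int_group_ring G"
  note mult = int_group_ring_mult[OF assms] and out = int_group_ring_mult_outside[OF assms(1)]
  have R: "carrier ?R = {f. \<forall>x. x \<notin> carrier G \<longrightarrow> f x = 0}" "\<zero>\<^bsub>?R\<^esub> = (\<lambda>x. 0)"
    "\<one>\<^bsub>?R\<^esub> = indicator {\<one>\<^bsub>G\<^esub>}" "\<And>f g. f \<oplus>\<^bsub>?R\<^esub> g = (\<lambda>x. f x + g x)"
    by (simp_all add: int_group_ring_def)
  show ?thesis
  proof (rule ringI)
    show "abelian_group ?R"
    proof (rule abelian_groupI)
      fix f assume "f \<in> carrier ?R"
      then show "\<exists>g\<in>carrier ?R. g \<oplus>\<^bsub>?R\<^esub> f = \<zero>\<^bsub>?R\<^esub>"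
        by (intro bexI[where x = "\<lambda>x. - f x"]) (auto simp: R)
    qed (auto simp: R algebra_simps)
    show "Group.monoid ?R"
    proof (rule monoidI)
      fix f g h
      show "f \<otimes>\<^bsub>?R\<^esub> g \<otimes>\<^bsub>?R\<^esub> h = f \<otimes>\<^bsub>?R\<^esub> (g \<otimes>\<^bsub>?R\<^esub> h)"
      proof
        fix x
        show "(f \<otimes>\<^bsub>?R\<^esub> g \<otimes>\<^bsub>?R\<^esub> h) x = (f \<otimes>\<^bsub>?R\<^esub> (g \<otimes>\<^bsub>?R\<^esub> h)) x"
        proof (cases "x \<in> carrier G")
          case True
          have "(f \<otimes>\<^bsub>?R\<^esub> g \<otimes>\<^bsub>?R\<^esub> h) x =
            (\<Sum>y\<in>carrier G. \<Sum>z\<in>carrier G. f z * g (inv\<^bsub>G\<^esub> z \<otimes>\<^bsub>G\<^esub> y) * h (inv\<^bsub>G\<^esub> y \<otimes>\<^bsub>G\<^esub> x))"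
            using True by (simp add: mult sum_distrib_right)
          also have "\<dots> =
            (\<Sum>z\<in>carrier G. \<Sum>y\<in>carrier G. f z * g (inv\<^bsub>G\<^esub> z \<otimes>\<^bsub>G\<^esub> y) * h (inv\<^bsub>G\<^esub> y \<otimes>\<^bsub>G\<^esub> x))"
            by (rule sum.swap)
          also have "\<dots> =
            (\<Sum>z\<in>carrier G. \<Sum>w\<in>carrier G. f z * (g w * h (inv\<^bsub>G\<^esub> w \<otimes>\<^bsub>G\<^esub> (inv\<^bsub>G\<^esub> z \<otimes>\<^bsub>G\<^esub> x))))"
          proof (rule sum.cong[OF refl])
            fix z assume z: "z \<in> carrier G"
            show "(\<Sum>y\<in>carrier G. f z * g (inv\<^bsub>G\<^esub> z \<otimes>\<^bsub>G\<^esub> y) * h (inv\<^bsub>G\<^esub> y \<otimes>\<^bsub>G\<^esub> x)) =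
              (\<Sum>w\<in>carrier G. f z * (g w * h (inv\<^bsub>G\<^esub> w \<otimes>\<^bsub>G\<^esub> (inv\<^bsub>G\<^esub> z \<otimes>\<^bsub>G\<^esub> x))))"
              by (rule sum.reindex_bij_witness[where j = "\<lambda>y. inv\<^bsub>G\<^esub> z \<otimes>\<^bsub>G\<^esub> y" and i = "\<lambda>w. z \<otimes>\<^bsub>G\<^esub> w"])
                 (use z True in \<open>auto simp: m_assoc[symmetric] inv_mult_group\<close>,
                  use z True in \<open>simp add: m_assoc\<close>)
          qed
          also have "\<dots> = (f \<otimes>\<^bsub>?R\<^esub> (g \<otimes>\<^bsub>?R\<^esub> h)) x"
            using True by (simp add: mult sum_distrib_left)
          finally show ?thesis .
        qed (simp add: out)
      qed
    next
      fix f assume f: "f \<in> carrier ?R"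
      show "\<one>\<^bsub>?R\<^esub> \<otimes>\<^bsub>?R\<^esub> f = f"
      proof
        fix x show "(\<one>\<^bsub>?R\<^esub> \<otimes>\<^bsub>?R\<^esub> f) x = f x"
        proof (cases "x \<in> carrier G")
          case True
          have "(\<one>\<^bsub>?R\<^esub> \<otimes>\<^bsub>?R\<^esub> f) x =
            (\<Sum>y\<in>carrier G. if y = \<one>\<^bsub>G\<^esub> then f (inv\<^bsub>G\<^esub> y \<otimes>\<^bsub>G\<^esub> x) else 0)"
            using True unfolding mult[OF True] R by (intro sum.cong) (auto simp: indicator_def)
          then show ?thesis using True assms(2) by simp
        qed (use f in \<open>simp add: out R(1)\<close>)
      qed
      show "f \<otimes>\<^bsub>?R\<^esub> \<one>\<^bsub>?R\<^esub> = f"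
      proof
        fix x show "(f \<otimes>\<^bsub>?R\<^esub> \<one>\<^bsub>?R\<^esub>) x = f x"
        proof (cases "x \<in> carrier G")
          case True
          have "inv\<^bsub>G\<^esub> y \<otimes>\<^bsub>G\<^esub> x = \<one>\<^bsub>G\<^esub> \<longleftrightarrow> y = x" if "y \<in> carrier G" for y
            using that True by (metis inv_closed inv_equality inv_inv l_inv)
          then have "(f \<otimes>\<^bsub>?R\<^esub> \<one>\<^bsub>?R\<^esub>) x = (\<Sum>y\<in>carrier G. if y = x then f y else 0)"
            using True unfolding mult[OF True] R by (intro sum.cong) (auto simp: indicator_def)
          then show ?thesis using True assms(2) by simp
        qed (use f in \<open>simp add: out R(1)\<close>)
      qed
    next
      show "\<one>\<^bsub>?R\<^esub> \<in> carrier ?R" by (auto simp: R indicator_def)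
    qed (simp add: R(1) out)
    fix f g h
    show "(f \<oplus>\<^bsub>?R\<^esub> g) \<otimes>\<^bsub>?R\<^esub> h = f \<otimes>\<^bsub>?R\<^esub> h \<oplus>\<^bsub>?R\<^esub> g \<otimes>\<^bsub>?R\<^esub> h"
      and "h \<otimes>\<^bsub>?R\<^esub> (f \<oplus>\<^bsub>?R\<^esub> g) = h \<otimes>\<^bsub>?R\<^esub> f \<oplus>\<^bsub>?R\<^esub> h \<otimes>\<^bsub>?R\<^esub> g"
      by (simp_all add: int_group_ring_def fun_eq_iff split_def algebra_simps sum.distrib)
  qed
qed

end

theory Submission
  imports Defs
begin

text \<open>
  Mapping \<open>(x, 1)\<close> to \<open>(x, 0)\<close> and \<open>(x, a)\<close> to \<open>(x, 1)\<close> identifies \<open>Cay(G, Sa)\<close> with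
  \<open>Cay(H, S) \<times> K\<^sub>2\<close>. As \<open>Cay(H, S)\<close> is connected and non-bipartite, every automorphism of the
  latter preserves or swaps the two layers, and so the automorphisms commuting with the layer swap
  form a copy of \<open>Aut(Cay(H, S)) \<times> \<int>\<^sub>2\<close>; by counting, stability means that all automorphisms
  commute with the swap. On the other side, for \<open>B\<close> containing the right translations, the span of
  the orbits of \<open>B\<^sub>1\<close> is an S-ring, and it contains the sum of \<open>T\<close> if and only if
  \<open>B \<le> Aut(Cay(G, T))\<close>. Commuting with the swap means lying in \<open>Aut(Cay(G, {a}))\<close>, so both
  statements say that \<open>Aut(Cay(G, Sa))\<close> is not contained in \<open>Aut(Cay(G, {a}))\<close>; preservation of
  the layers is containment in \<open>Aut(Cay(G, H))\<close>, where the latter graph has loops.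
\<close>

subsection \<open>Automorphisms of Cayley graphs and transitivity modules\<close>

text \<open>Every point of \<open>C\<close> lies in exactly one block, so a combination of block
  indicators takes at that point the coefficient of its block. Membership in the span thus becomes a
  condition on the values of \<open>f\<close>, with no coefficients to be found.\<close>

lemma int_span_partition:
  assumes "partition_on C P" and "finite C"
  shows "int_span (set_sum ` P) =
    {f. (\<forall>x. x \<notin> C \<longrightarrow> f x = 0) \<and> (\<forall>X \<in> P. \<forall>x \<in> X. \<forall>y \<in> X. f x = f y)}" (is "_ = ?R")
proof
  have disj: "X = Y" if "X \<in> P" "Y \<in> P" "x \<in> X" "x \<in> Y" for X Y x
    using assms(1) that by (auto simp: partition_on_def disjoint_def)
  have un: "\<Union>P = C" using assms(1) by (simp add: partition_on_def)
  show "int_span (set_sum ` P) \<subseteq> ?R"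
  proof
    fix f assume "f \<in> int_span (set_sum ` P)"
    then obtain c T where f: "f = (\<lambda>x. \<Sum>g\<in>T. c g * g x)" and T: "T \<subseteq> set_sum ` P"
      by (auto simp: int_span_def)
    have "g x = 0" if "g \<in> T" "x \<notin> C" for g x
      using that T un by (auto simp: set_sum_def indicator_def)
    then have zero: "(\<Sum>g\<in>T. c g * g x) = 0" if "x \<notin> C" for x
      using that by (intro sum.neutral) auto
    have const: "g x = g y" if g: "g \<in> T" and X: "X \<in> P" "x \<in> X" "y \<in> X" for g x y X
    proof -
      obtain Y where "Y \<in> P" "g = set_sum Y" using T g by blast
      moreover from this have "x \<in> Y \<longleftrightarrow> y \<in> Y" using X disj by metis
      ultimately show ?thesis by (simp add: set_sum_def indicator_def)
    qed
    have "(\<Sum>g\<in>T. c g * g x) = (\<Sum>g\<in>T. c g * g y)" if X: "X \<in> P" "x \<in> X" "y \<in> X" for x y X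
      by (intro sum.cong refl arg_cong2[of _ _ _ _ "(*)"] const[OF _ X])
    then show "f \<in> ?R" unfolding f using zero by blast
  qed
  show "?R \<subseteq> int_span (set_sum ` P)"
  proof
    fix f assume f: "f \<in> ?R"
    \<comment> \<open>\<open>int_span\<close> attaches coefficients to functions, not to blocks. The
      block is therefore recovered from its indicator as the set where the value is 1; which of its
      points is chosen does not matter, as \<open>f\<close> is constant there.\<close>
    let ?T = "set_sum ` P" and ?c = "\<lambda>g :: _ \<Rightarrow> int. f (SOME x. g x = 1)"
    have "finite P" using assms finite_UnionD un by blast
    then have fin: "finite ?T" by simp
    have "f x = (\<Sum>g\<in>?T. ?c g * g x)" for x
    proof (cases "x \<in> C")
      case True
      then obtain X where X: "X \<in> P" "x \<in> X" using un by auto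
      have one: "set_sum X y = 1 \<longleftrightarrow> y \<in> X" for y
        by (simp add: set_sum_def indicator_def)
      have "(SOME y. set_sum X y = 1) \<in> X" unfolding one using X(2) by (rule someI)
      then have c: "?c (set_sum X) = f x" using f X by blast
      have "g x = 0" if g: "g \<in> ?T - {set_sum X}" for g
      proof -
        obtain Y where "Y \<in> P" "g = set_sum Y" "Y \<noteq> X" using g by blast
        moreover from this have "x \<notin> Y" using X disj by metis
        ultimately show ?thesis by (simp add: set_sum_def)
      qed
      then have "(\<Sum>g\<in>?T - {set_sum X}. ?c g * g x) = 0"
        by (intro sum.neutral) auto
      then have "(\<Sum>g\<in>?T. ?c g * g x) = ?c (set_sum X) * set_sum X x"
        using fin X(1) by (subst sum.remove[of _ "set_sum X"]) auto
      then show ?thesis using c one X(2) by simp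
    next
      case False
      then have "g x = 0" if "g \<in> ?T" for g
        using that un by (auto simp: set_sum_def indicator_def)
      then have "(\<Sum>g\<in>?T. ?c g * g x) = 0"
        by (intro sum.neutral) auto
      then show ?thesis using f False by simp
    qed
    then have "f = (\<lambda>x. \<Sum>g\<in>?T. ?c g * g x)" by blast
    with fin show "f \<in> int_span ?T"
      unfolding int_span_def by (intro CollectI exI[of _ ?c] exI[of _ ?T] conjI subset_refl)
  qed
qed

text \<open>Arcs multiply on the left, so cancelling \<open>x\<close> on the right recovers the
  connection element. The quotient \<open>y \<otimes> inv x\<close> is the form in which arcs are
  compared with right translations and with point stabilizers.\<close>

lemma parcs_cayley_graph_iff:
  assumes "group G" and "T \<subseteq> carrier G" and "x \<in> carrier G" and "y \<in> carrier G"
  shows "(x, y) \<in> parcs (cayley_graph G T) \<longleftrightarrow> y \<otimes>\<^bsub>G\<^esub> inv\<^bsub>G\<^esub> x \<in> T"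
proof -
  interpret group G by fact
  have "y = (y \<otimes>\<^bsub>G\<^esub> inv\<^bsub>G\<^esub> x) \<otimes>\<^bsub>G\<^esub> x" using assms by (simp add: m_assoc)
  moreover have "(s \<otimes>\<^bsub>G\<^esub> x) \<otimes>\<^bsub>G\<^esub> inv\<^bsub>G\<^esub> x = s" if "s \<in> T" for s
    using assms that by (auto simp: m_assoc)
  ultimately show ?thesis using assms by (auto simp: cayley_graph_def)
qed

lemma pverts_cayley_graph [simp]: "pverts (cayley_graph G T) = carrier G"
  by (simp add: cayley_graph_def)

lemma subgroup_graph_automorphisms:
  "subgroup (graph_automorphisms \<Gamma>) (BijGroup (pverts \<Gamma>))"
proof (rule subgroup.intro)
  show "graph_automorphisms \<Gamma> \<subseteq> carrier (BijGroup (pverts \<Gamma>))"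
    by (auto simp: graph_automorphisms_def BijGroup_def)
next
  fix f g assume "f \<in> graph_automorphisms \<Gamma>" "g \<in> graph_automorphisms \<Gamma>"
  then show "f \<otimes>\<^bsub>BijGroup (pverts \<Gamma>)\<^esub> g \<in> graph_automorphisms \<Gamma>"
    using Bij_imp_funcset[of g]
    by (auto simp: graph_automorphisms_def BijGroup_def compose_Bij compose_eq Pi_iff)
next
  show "\<one>\<^bsub>BijGroup (pverts \<Gamma>)\<^esub> \<in> graph_automorphisms \<Gamma>"
    by (simp add: graph_automorphisms_def BijGroup_def id_Bij)
next
  fix f assume f: "f \<in> graph_automorphisms \<Gamma>"
  then have bij: "f \<in> Bij (pverts \<Gamma>)" by (simp add: graph_automorphisms_def)
  then have "f (inv_into (pverts \<Gamma>) f u) = u" "inv_into (pverts \<Gamma>) f u \<in> pverts \<Gamma>"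
    if "u \<in> pverts \<Gamma>" for u
    using that by (auto simp: Bij_def bij_betw_inv_into_right bij_betw_def intro: inv_into_into)
  then show "inv\<^bsub>BijGroup (pverts \<Gamma>)\<^esub> f \<in> graph_automorphisms \<Gamma>"
    using f bij by (simp add: graph_automorphisms_def inv_BijGroup restrict_inv_into_Bij)
qed

lemma group_Aut: "group (Aut \<Gamma>)"
  unfolding Aut_def
  by (rule subgroup.subgroup_is_group[OF subgroup_graph_automorphisms group_BijGroup])

text \<open>In the quotient of \<open>v \<otimes> g\<close> by \<open>u \<otimes> g\<close> the
  factor \<open>g\<close> cancels. This makes the automorphism group of a Cayley graph on a finite
  group an instance of the locale below.\<close>

lemma right_translations_subset_graph_automorphisms:
  assumes "group G" and T: "T \<subseteq> carrier G"
  shows "right_translations G \<subseteq> graph_automorphisms (cayley_graph G T)"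
proof
  interpret group G by fact
  fix f assume "f \<in> right_translations G"
  then obtain g where g: "g \<in> carrier G" and f: "f = (\<lambda>x \<in> carrier G. x \<otimes>\<^bsub>G\<^esub> g)"
    by (auto simp: right_translations_def)
  have "bij_betw f (carrier G) (carrier G)"
    by (rule bij_betw_byWitness[where f' = "\<lambda>x. x \<otimes>\<^bsub>G\<^esub> inv\<^bsub>G\<^esub> g"])
       (use g in \<open>auto simp: f m_assoc\<close>)
  moreover have "f v \<otimes>\<^bsub>G\<^esub> inv\<^bsub>G\<^esub> f u = v \<otimes>\<^bsub>G\<^esub> inv\<^bsub>G\<^esub> u"
    if "u \<in> carrier G" "v \<in> carrier G" for u v
  proof -
    have "g \<otimes>\<^bsub>G\<^esub> (inv\<^bsub>G\<^esub> g \<otimes>\<^bsub>G\<^esub> inv\<^bsub>G\<^esub> u) = inv\<^bsub>G\<^esub> u"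
      using g that by (simp add: m_assoc[symmetric])
    then show ?thesis using g that by (simp add: f inv_mult_group m_assoc)
  qed
  moreover have "f u \<in> carrier G" if "u \<in> carrier G" for u using f g that by simp
  ultimately show "f \<in> graph_automorphisms (cayley_graph G T)"
    using f by (simp add: graph_automorphisms_def Bij_def parcs_cayley_graph_iff[OF is_group T])
qed

section \<open>Permutation groups containing the right translations\<close>

locale translation_overgroup = group G for G :: "('a, 'm) monoid_scheme" (structure) +
  fixes B :: "('a \<Rightarrow> 'a) set"
  assumes finite_carrier: "finite (carrier G)"
    and subgroup_B: "subgroup B (BijGroup (carrier G))"
    and translations_B: "right_translations G \<subseteq> B"
begin

definition point_stabilizer :: "('a \<Rightarrow> 'a) set" where
  "point_stabilizer = {b \<in> B. b \<one> = \<one>}"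

lemma B_Bij: "b \<in> B \<Longrightarrow> b \<in> Bij (carrier G)"
  using subgroup.subset[OF subgroup_B] by (auto simp: BijGroup_def)

lemma B_closed: "b \<in> B \<Longrightarrow> x \<in> carrier G \<Longrightarrow> b x \<in> carrier G"
  using Bij_imp_funcset[OF B_Bij] by auto

lemma B_compose: "b \<in> B \<Longrightarrow> c \<in> B \<Longrightarrow> compose (carrier G) b c \<in> B"
  using subgroup.m_closed[OF subgroup_B, of b c] by (simp add: BijGroup_def B_Bij)

lemma stabilizer_id: "(\<lambda>x \<in> carrier G. x) \<in> point_stabilizer"
  using subgroup.one_closed[OF subgroup_B] by (simp add: BijGroup_def point_stabilizer_def)

lemma orbit_refl: "x \<in> carrier G \<Longrightarrow> x \<in> (\<lambda>b. b x) ` point_stabilizer"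
  by (rule image_eqI[OF _ stabilizer_id]) simp

lemma stabilizer_compose:
  "b \<in> point_stabilizer \<Longrightarrow> c \<in> point_stabilizer \<Longrightarrow> compose (carrier G) b c \<in> point_stabilizer"
  by (simp add: point_stabilizer_def B_compose compose_eq)

lemma stabilizer_inverse:
  assumes "b \<in> point_stabilizer"
  obtains c where "c \<in> point_stabilizer" "\<And>x. x \<in> carrier G \<Longrightarrow> c (b x) = x"
proof
  let ?c = "\<lambda>x \<in> carrier G. inv_into (carrier G) b x"
  have b: "b \<in> B" "b \<one> = \<one>" using assms by (auto simp: point_stabilizer_def)
  have "?c \<in> B"
    using subgroup.m_inv_closed[OF subgroup_B b(1)] inv_BijGroup[OF B_Bij[OF b(1)]] by simp
  moreover show c: "?c (b x) = x" if "x \<in> carrier G" for x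
    using that B_Bij[OF b(1)] B_closed[OF b(1)]
    by (simp add: Bij_def bij_betw_inv_into_left[of b "carrier G" "carrier G"])
  ultimately show "?c \<in> point_stabilizer"
    using c[of \<one>] b(2) by (simp add: point_stabilizer_def)
qed

lemma stabilizer_translate:
  assumes "b \<in> B" "y \<in> carrier G"
  obtains c where "c \<in> point_stabilizer"
    "\<And>x. x \<in> carrier G \<Longrightarrow> c (x \<otimes> inv y) = b x \<otimes> inv (b y)"
proof
  let ?r = "\<lambda>g. \<lambda>x \<in> carrier G. x \<otimes> g"
  let ?c = "compose (carrier G) (?r (inv (b y))) (compose (carrier G) b (?r y))"
  have r: "?r g \<in> B" if "g \<in> carrier G" for g
    using that translations_B by (auto simp: right_translations_def)
  have byG: "b y \<in> carrier G" using assms by (rule B_closed)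
  show "?c \<in> point_stabilizer"
    using assms byG r by (simp add: point_stabilizer_def B_compose compose_eq)
  show "?c (x \<otimes> inv y) = b x \<otimes> inv (b y)" if "x \<in> carrier G" for x
    using that assms byG B_closed by (simp add: compose_eq m_assoc)
qed

lemma stabilizer_orbits_eq:
  "stabilizer_orbits G B = (\<lambda>x. (\<lambda>b. b x) ` point_stabilizer) ` carrier G"
  by (auto simp: stabilizer_orbits_def orbits_def orbit_def stabilizer_def point_stabilizer_def)

lemma partition_on_stabilizer_orbits: "partition_on (carrier G) (stabilizer_orbits G B)"
proof -
  have sub: "(\<lambda>b. b x) ` point_stabilizer \<subseteq> (\<lambda>b. b y) ` point_stabilizer"
    if b: "b \<in> point_stabilizer" "c \<in> point_stabilizer" "b x = c y"
      and xy: "x \<in> carrier G" "y \<in> carrier G" for b c x y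
  proof (rule image_subsetI)
    obtain b' where b': "b' \<in> point_stabilizer" "\<And>x. x \<in> carrier G \<Longrightarrow> b' (b x) = x"
      using stabilizer_inverse[OF b(1)] by blast
    fix d assume d: "d \<in> point_stabilizer"
    \<comment> \<open>As \<open>c y = b x\<close> and \<open>b'\<close> undoes \<open>b\<close> at
      \<open>x\<close>, this element of the stabilizer takes \<open>y\<close> to
      \<open>d x\<close>.\<close>
    let ?e = "compose (carrier G) d (compose (carrier G) b' c)"
    have "?e \<in> point_stabilizer" using d b' b by (intro stabilizer_compose)
    moreover have "?e y = d x" using xy b(3)[symmetric] b'(2) by (simp add: compose_eq)
    ultimately show "d x \<in> (\<lambda>b. b y) ` point_stabilizer" by (metis imageI)
  qed
  have orbit_sub: "(\<lambda>b. b x) ` point_stabilizer \<subseteq> carrier G" if "x \<in> carrier G" for x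
    using that B_closed by (auto simp: point_stabilizer_def)
  have "disjoint (stabilizer_orbits G B)"
    unfolding stabilizer_orbits_eq
  proof (rule disjointI, clarify)
    fix x y assume xy: "x \<in> carrier G" "y \<in> carrier G"
      and neq: "(\<lambda>b. b x) ` point_stabilizer \<noteq> (\<lambda>b. b y) ` point_stabilizer"
    show "(\<lambda>b. b x) ` point_stabilizer \<inter> (\<lambda>b. b y) ` point_stabilizer = {}"
    proof (rule ccontr)
      assume "\<not> ?thesis"
      then obtain b c where "b \<in> point_stabilizer" "c \<in> point_stabilizer" "b x = c y" by blast
      then have "(\<lambda>b. b x) ` point_stabilizer = (\<lambda>b. b y) ` point_stabilizer"
        using sub[of b c x y] sub[of c b y x] xy by (intro equalityI) simp_all
      with neq show False ..
    qed
  qed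
  moreover have "point_stabilizer \<noteq> {}" using stabilizer_id by blast
  moreover have "\<Union>(stabilizer_orbits G B) = carrier G"
    unfolding stabilizer_orbits_eq
  proof (rule equalityI)
    show "carrier G \<subseteq> \<Union>((\<lambda>x. (\<lambda>b. b x) ` point_stabilizer) ` carrier G)"
    proof
      fix x assume x: "x \<in> carrier G"
      then show "x \<in> \<Union>((\<lambda>x. (\<lambda>b. b x) ` point_stabilizer) ` carrier G)"
        using orbit_refl[OF x] by (rule UN_I)
    qed
  qed (use orbit_sub in \<open>auto simp: subset_iff\<close>)
  ultimately show ?thesis
    unfolding partition_on_def by (auto simp: stabilizer_orbits_eq)
qed

abbreviation transitivity_module :: "('a \<Rightarrow> int) set" where
  "transitivity_module \<equiv> int_span (set_sum ` stabilizer_orbits G B)"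

text \<open>Constancy on orbits is invariance under the group. From here on the module is handled as
  the set of stabilizer-invariant functions, and orbits return only for the partition axioms of an
  S-ring.\<close>

lemma transitivity_module_iff:
  "f \<in> transitivity_module \<longleftrightarrow>
    (\<forall>x. x \<notin> carrier G \<longrightarrow> f x = 0) \<and> (\<forall>b \<in> point_stabilizer. \<forall>x \<in> carrier G. f (b x) = f x)"
proof -
  have "(\<forall>X \<in> stabilizer_orbits G B. \<forall>x \<in> X. \<forall>y \<in> X. f x = f y) \<longleftrightarrow>
      (\<forall>b \<in> point_stabilizer. \<forall>x \<in> carrier G. f (b x) = f x)" (is "?L \<longleftrightarrow> ?R")
  proof
    assume ?L
    show ?R
    proof (intro ballI)
      fix b x assume b: "b \<in> point_stabilizer" and x: "x \<in> carrier G"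
      let ?X = "(\<lambda>b. b x) ` point_stabilizer"
      have X: "?X \<in> stabilizer_orbits G B" unfolding stabilizer_orbits_eq using x by (rule imageI)
      have "b x \<in> ?X" using b by (rule imageI)
      then show "f (b x) = f x" by (rule bspec[OF bspec[OF bspec[OF \<open>?L\<close> X]] orbit_refl[OF x]])
    qed
  qed (auto simp: stabilizer_orbits_eq)
  then show ?thesis
    by (simp add: int_span_partition[OF partition_on_stabilizer_orbits finite_carrier])
qed

text \<open>This is the bridge between S-rings and graphs. If \<open>T\<close> is invariant under
  the stabilizer, \<open>stabilizer_translate\<close> shows that every \<open>b\<close> in
  \<open>B\<close> preserves the condition that a quotient lies in \<open>T\<close>, hence preserves
  arcs. Conversely, \<open>T\<close> is the set of out-neighbours of the identity, so automorphisms
  fixing the identity preserve it.\<close>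

lemma set_sum_in_transitivity_module_iff:
  assumes T: "T \<subseteq> carrier G"
  shows "set_sum T \<in> transitivity_module \<longleftrightarrow> B \<subseteq> graph_automorphisms (cayley_graph G T)"
proof -
  note arc = parcs_cayley_graph_iff[OF is_group T]
  have "set_sum T \<in> transitivity_module \<longleftrightarrow>
      (\<forall>b \<in> point_stabilizer. \<forall>x \<in> carrier G. b x \<in> T \<longleftrightarrow> x \<in> T)"
    unfolding transitivity_module_iff using T
    by (auto simp: set_sum_def indicator_def split: if_splits)
  also have "\<dots> \<longleftrightarrow> B \<subseteq> graph_automorphisms (cayley_graph G T)" (is "?L \<longleftrightarrow> ?R")
  proof
    assume L: ?L
    show ?R
    proof
      fix b assume b: "b \<in> B"
      have "v \<otimes> inv u \<in> T \<longleftrightarrow> b v \<otimes> inv (b u) \<in> T"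
        if uv: "u \<in> carrier G" "v \<in> carrier G" for u v
      proof -
        obtain c where "c \<in> point_stabilizer" "c (v \<otimes> inv u) = b v \<otimes> inv (b u)"
          using stabilizer_translate[OF b uv(1)] uv(2) by blast
        moreover have "v \<otimes> inv u \<in> carrier G" using uv by simp
        ultimately show ?thesis using L by metis
      qed
      then show "b \<in> graph_automorphisms (cayley_graph G T)"
        using b by (simp add: graph_automorphisms_def B_Bij B_closed arc)
    qed
  next
    assume R: ?R
    show ?L
    proof (intro ballI)
      fix b x assume b: "b \<in> point_stabilizer" and x: "x \<in> carrier G"
      then have "(\<one>, x) \<in> parcs (cayley_graph G T) \<longleftrightarrow> (b \<one>, b x) \<in> parcs (cayley_graph G T)"
        using R by (auto simp: point_stabilizer_def graph_automorphisms_def)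
      then show "b x \<in> T \<longleftrightarrow> x \<in> T"
        using b x B_closed by (simp add: point_stabilizer_def arc)
    qed
  qed
  finally show ?thesis .
qed

text \<open>Reindex the convolution at \<open>b x\<close> by the bijection \<open>b\<close>. The
  factor \<open>f\<close> sees only a quotient, whose image stays in the same orbit by
  \<open>stabilizer_translate\<close>, and the factor \<open>g\<close> is invariant under
  \<open>b\<close> itself.\<close>

lemma transitivity_module_mult:
  assumes f: "f \<in> transitivity_module" and g: "g \<in> transitivity_module"
  shows "f \<otimes>\<^bsub>int_group_ring G\<^esub> g \<in> transitivity_module"
  unfolding transitivity_module_iff
proof (intro conjI ballI allI impI)
  \<comment> \<open>Substituting \<open>z = inv y \<otimes> x\<close> gives the form compatible with right translations.\<close>
  have mult: "(f \<otimes>\<^bsub>int_group_ring G\<^esub> g) x = (\<Sum>z\<in>carrier G. f (x \<otimes> inv z) * g z)"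
    if "x \<in> carrier G" for x
    unfolding int_group_ring_mult[OF is_group finite_carrier that]
  proof (rule sum.reindex_bij_witness[where j = "\<lambda>y. inv y \<otimes> x" and i = "\<lambda>z. x \<otimes> inv z"])
    fix y assume y: "y \<in> carrier G"
    have "x \<otimes> (inv x \<otimes> y) = y" using y that by (simp add: m_assoc[symmetric])
    then show "x \<otimes> inv (inv y \<otimes> x) = y"
      and "f (x \<otimes> inv (inv y \<otimes> x)) * g (inv y \<otimes> x) = f y * g (inv y \<otimes> x)"
      using y that by (simp_all add: inv_mult_group)
  qed (use that in \<open>auto simp: inv_mult_group m_assoc\<close>)
  fix b x assume b: "b \<in> point_stabilizer" and x: "x \<in> carrier G"
  have bB: "b \<in> B" using b by (simp add: point_stabilizer_def)
  have inv: "f (b x \<otimes> inv (b z)) = f (x \<otimes> inv z)" if z: "z \<in> carrier G" for z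
  proof -
    obtain c where "c \<in> point_stabilizer" "c (x \<otimes> inv z) = b x \<otimes> inv (b z)"
      using stabilizer_translate[OF bB z] x by blast
    moreover have "x \<otimes> inv z \<in> carrier G" using x z by simp
    ultimately show ?thesis using f unfolding transitivity_module_iff by metis
  qed
  have bij: "bij_betw b (carrier G) (carrier G)" using B_Bij[OF bB] by (simp add: Bij_def)
  have "(\<Sum>z\<in>carrier G. f (b x \<otimes> inv z) * g z) = (\<Sum>z\<in>carrier G. f (b x \<otimes> inv (b z)) * g (b z))"
    by (rule sum.reindex_bij_betw[OF bij, symmetric])
  also have "\<dots> = (\<Sum>z\<in>carrier G. f (x \<otimes> inv z) * g z)"
    using g b by (intro sum.cong) (simp_all add: inv transitivity_module_iff)
  finally show "(f \<otimes>\<^bsub>int_group_ring G\<^esub> g) (b x) = (f \<otimes>\<^bsub>int_group_ring G\<^esub> g) x"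
    using x B_closed[OF bB] by (simp add: mult)
qed (rule int_group_ring_mult_outside[OF is_group])

text \<open>Schur's theorem on transitivity modules. The subring axioms are closure properties of
  invariant functions; the orbit of the identity is a singleton because stabilizer elements are
  injective and fix it.\<close>

lemma S_ring_transitivity_module: "S_ring G transitivity_module"
proof -
  interpret R: ring "int_group_ring G" by (rule ring_int_group_ring[OF is_group finite_carrier])
  have minus: "\<ominus>\<^bsub>int_group_ring G\<^esub> f = (\<lambda>x. - f x)" if "f \<in> carrier (int_group_ring G)" for f
    by (rule R.minus_equality) (use that in \<open>auto simp: int_group_ring_def\<close>)
  have sub: "transitivity_module \<subseteq> carrier (int_group_ring G)"
    by (auto simp: transitivity_module_iff int_group_ring_def)
  have fix1: "b x = \<one> \<longleftrightarrow> x = \<one>" if "b \<in> point_stabilizer" "x \<in> carrier G" for b x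
  proof -
    have b: "b \<in> B" "b \<one> = \<one>" using that(1) by (auto simp: point_stabilizer_def)
    then have "inj_on b (carrier G)" using B_Bij by (simp add: Bij_def bij_betw_def)
    then show ?thesis using inj_on_eq_iff[of b "carrier G" x \<one>] that(2) b(2) by simp
  qed
  have subring: "subring transitivity_module (int_group_ring G)"
  proof (rule R.subringI[OF sub])
    show "\<one>\<^bsub>int_group_ring G\<^esub> \<in> transitivity_module"
      by (auto simp: transitivity_module_iff int_group_ring_def indicator_def fix1)
    show "\<ominus>\<^bsub>int_group_ring G\<^esub> f \<in> transitivity_module" if f: "f \<in> transitivity_module" for f
      using f unfolding minus[OF subsetD[OF sub f]] by (simp add: transitivity_module_iff)
    show "f \<oplus>\<^bsub>int_group_ring G\<^esub> g \<in> transitivity_module"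
      if "f \<in> transitivity_module" "g \<in> transitivity_module" for f g
      using that by (simp add: transitivity_module_iff int_group_ring_def)
  qed (rule transitivity_module_mult)
  have one: "{\<one>} \<in> stabilizer_orbits G B"
    unfolding stabilizer_orbits_eq
    by (rule image_eqI[of _ _ \<one>]) (use orbit_refl[of \<one>] in \<open>auto simp: fix1\<close>)
  \<comment> \<open>The stabilizer need not commute with inversion. Applying
    \<open>stabilizer_translate\<close> to the pair \<open>\<one>\<close>, \<open>x\<close> yields
    another stabilizer element \<open>c\<close> that takes \<open>inv x\<close> to
    \<open>inv (b x)\<close>, which is enough for orbits.\<close>
  have inv: "inv (b x) \<in> (\<lambda>b. b (inv x)) ` point_stabilizer"
    if "b \<in> point_stabilizer" and x: "x \<in> carrier G" for b x
  proof -
    have b: "b \<in> B" "b \<one> = \<one>" using that by (auto simp: point_stabilizer_def)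
    obtain c where "c \<in> point_stabilizer" "c (\<one> \<otimes> inv x) = b \<one> \<otimes> inv (b x)"
      using stabilizer_translate[OF b(1) x] by blast
    then show ?thesis
      using b x B_closed by (intro image_eqI[of _ _ c]) simp_all
  qed
  have "\<forall>X\<in>stabilizer_orbits G B. set_inv X \<in> stabilizer_orbits G B"
  proof
    fix X assume "X \<in> stabilizer_orbits G B"
    then obtain x where x: "x \<in> carrier G" and X: "X = (\<lambda>b. b x) ` point_stabilizer"
      by (auto simp: stabilizer_orbits_eq)
    have "b (inv x) \<in> set_inv X" if b: "b \<in> point_stabilizer" for b
    proof -
      have "inv (b (inv x)) \<in> X" using inv[OF b inv_closed[OF x]] x by (simp add: X)
      moreover have "b (inv x) \<in> carrier G"
        using b x B_closed by (auto simp: point_stabilizer_def)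
      ultimately show ?thesis by (auto simp: SET_INV_def intro!: bexI[of _ "inv (b (inv x))"])
    qed
    moreover have "set_inv X \<subseteq> (\<lambda>b. b (inv x)) ` point_stabilizer"
      unfolding SET_INV_def X using inv x by blast
    ultimately have "set_inv X = (\<lambda>b. b (inv x)) ` point_stabilizer" by blast
    then show "set_inv X \<in> stabilizer_orbits G B"
      unfolding stabilizer_orbits_eq using inv_closed[OF x] by blast
  qed
  with one partition_on_stabilizer_orbits
  have "\<exists>P. partition_on (carrier G) P \<and> {\<one>} \<in> P \<and> (\<forall>X\<in>P. set_inv X \<in> P) \<and>
      transitivity_module = int_span (set_sum ` P)"
    by (intro exI[of _ "stabilizer_orbits G B"] conjI refl)
  with subring show ?thesis unfolding S_ring_def by (rule conjI)
qed

lemma Schurian_transitivity_module: "Schurian G transitivity_module"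
  unfolding Schurian_def using subgroup_B translations_B by blast

end

subsection \<open>Automorphisms of the direct product with \<open>K\<^sub>2\<close>\<close>

text \<open>Conjugation by a graph isomorphism. Only the intertwining equation is kept, since later
  arguments evaluate the transported map at vertices alone; it is applied in both directions between
  \<open>Cay(G, Sa)\<close> and the direct product.\<close>

lemma graph_automorphism_transport:
  assumes \<phi>: "bij_betw \<phi> (pverts \<Gamma>) (pverts \<Delta>)"
    and arcs: "\<And>u v. u \<in> pverts \<Gamma> \<Longrightarrow> v \<in> pverts \<Gamma> \<Longrightarrow>
      (u, v) \<in> parcs \<Gamma> \<longleftrightarrow> (\<phi> u, \<phi> v) \<in> parcs \<Delta>"
    and f: "f \<in> graph_automorphisms \<Gamma>"
  obtains f' where "f' \<in> graph_automorphisms \<Delta>" "\<And>u. u \<in> pverts \<Gamma> \<Longrightarrow> f' (\<phi> u) = \<phi> (f u)"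
proof
  let ?\<psi> = "inv_into (pverts \<Gamma>) \<phi>"
  let ?f = "\<lambda>w \<in> pverts \<Delta>. \<phi> (f (?\<psi> w))"
  have bf: "bij_betw f (pverts \<Gamma>) (pverts \<Gamma>)"
    using f by (simp add: graph_automorphisms_def Bij_def)
  have \<psi>: "?\<psi> w \<in> pverts \<Gamma>" "\<phi> (?\<psi> w) = w" if "w \<in> pverts \<Delta>" for w
    using that \<phi> by (auto simp: bij_betw_inv_into_right bij_betw_def intro: inv_into_into)
  have fV: "f u \<in> pverts \<Gamma>" if "u \<in> pverts \<Gamma>" for u using that bf by (rule bij_betw_apply[rotated])
  have "bij_betw (\<phi> \<circ> (f \<circ> ?\<psi>)) (pverts \<Delta>) (pverts \<Delta>)"
    by (intro bij_betw_trans[OF bij_betw_trans[OF bij_betw_inv_into[OF \<phi>] bf] \<phi>])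
  then have "?f \<in> Bij (pverts \<Delta>)" by (simp add: Bij_def comp_def)
  moreover have "(w, z) \<in> parcs \<Delta> \<longleftrightarrow> (?f w, ?f z) \<in> parcs \<Delta>"
    if "w \<in> pverts \<Delta>" "z \<in> pverts \<Delta>" for w z
    using that f \<psi> fV arcs[of "?\<psi> w" "?\<psi> z"] arcs[of "f (?\<psi> w)" "f (?\<psi> z)"]
    by (simp add: graph_automorphisms_def)
  ultimately show "?f \<in> graph_automorphisms \<Delta>" by (simp add: graph_automorphisms_def)
  show "?f (\<phi> u) = \<phi> (f u)" if "u \<in> pverts \<Gamma>" for u
    using that \<phi> by (simp add: bij_betw_inv_into_left bij_betw_apply)
qed

lemma pverts_times_K2 [simp]: "pverts (times_K2 \<Gamma>) = pverts \<Gamma> \<times> {0, 1}"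
  by (simp add: times_K2_def)

lemma finite_graph_automorphisms:
  assumes "finite (pverts \<Gamma>)"
  shows "finite (graph_automorphisms \<Gamma>)"
proof (rule finite_subset)
  show "graph_automorphisms \<Gamma> \<subseteq> (\<Pi>\<^sub>E u\<in>pverts \<Gamma>. pverts \<Gamma>)"
    by (auto simp: graph_automorphisms_def PiE_def Bij_imp_extensional dest: Bij_imp_funcset)
qed (use assms in \<open>simp add: finite_PiE\<close>)

section \<open>Layers of the direct product of a connected non-bipartite graph with
  \<open>K_2\<close>\<close>

locale connected_nonbipartite_graph = pair_graph \<Gamma> for \<Gamma> :: "'v pair_pre_digraph" +
  assumes connected_\<Gamma>: "Digraph_Component.connected (with_proj \<Gamma>)"
    and nonbipartite: "\<not> bipartite \<Gamma>"
begin

lemma arc_sym: "(u, v) \<in> parcs \<Gamma> \<Longrightarrow> (v, u) \<in> parcs \<Gamma>"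
  using sym_arcs by (auto simp: symmetric_def elim: symE)

lemma parcs_times_K2_iff:
  "((u, i), (v, j)) \<in> parcs (times_K2 \<Gamma>) \<longleftrightarrow> (u, v) \<in> parcs \<Gamma> \<and> (i = 0 \<and> j = 1 \<or> i = 1 \<and> j = 0)"
  using arc_sym by (auto simp: times_K2_def)

lemma arc_verts: "(u, v) \<in> parcs \<Gamma> \<Longrightarrow> u \<in> pverts \<Gamma> \<and> v \<in> pverts \<Gamma>"
  using arc_fst_in_verts arc_snd_in_verts by force

lemma pverts_nonempty: "pverts \<Gamma> \<noteq> {}"
  using connected_\<Gamma> by (auto simp: connected_def strongly_connected_def)

text \<open>Arcs occur in both directions, so connectedness gives a directed path from
  \<open>u\<close> to \<open>v\<close>, along which \<open>P\<close> is carried by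
  induction.\<close>

lemma connected_propagate:
  assumes "u \<in> pverts \<Gamma>" "v \<in> pverts \<Gamma>" "P u" "\<And>x y. (x, y) \<in> parcs \<Gamma> \<Longrightarrow> P x \<Longrightarrow> P y"
  shows "P v"
proof -
  have "strongly_connected (with_proj \<Gamma>)"
    using symmetric_connected_imp_strongly_connected connected_\<Gamma> sym_arcs by blast
  then have "(u, v) \<in> rtrancl_on (pverts \<Gamma>) (parcs \<Gamma>)"
    using assms(1,2) by (auto simp: strongly_connected_def reachable_def)
  then show ?thesis using assms(3,4) by (induct rule: rtrancl_on_induct) auto
qed

text \<open>
  Let \<open>e\<^sub>i u\<close> be the amount by which \<open>f\<close> changes the layer of \<open>(u, i)\<close>. Along an edge \<open>{u, v}\<close>
  one has \<open>e\<^sub>0 u = e\<^sub>1 v\<close> and \<open>e\<^sub>1 u = e\<^sub>0 v\<close>, so either both are one and the same constant or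
  \<open>e\<^sub>0\<close> is a proper 2-colouring.
\<close>

lemma automorphism_times_K2_layers:
  assumes f: "f \<in> graph_automorphisms (times_K2 \<Gamma>)"
  obtains e where "e = 0 \<or> e = 1"
    "\<And>u i. u \<in> pverts \<Gamma> \<Longrightarrow> i = 0 \<or> i = 1 \<Longrightarrow> snd (f (u, i)) = (i + e) mod 2"
proof -
  define e0 where "e0 = (\<lambda>u. snd (f (u, 0)))"
  \<comment> \<open>Subtraction here is on \<open>nat\<close>; it measures the change of layer
    because at vertices the value of \<open>snd\<close> is 0 or 1.\<close>
  define e1 where "e1 = (\<lambda>u. 1 - snd (f (u, 1)))"
  have bij: "bij_betw f (pverts \<Gamma> \<times> {0, 1}) (pverts \<Gamma> \<times> {0, 1})"
    using f by (simp add: graph_automorphisms_def Bij_def)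
  have mem: "f (u, i) \<in> pverts \<Gamma> \<times> {0, 1}" if "u \<in> pverts \<Gamma>" "i = 0 \<or> i = 1" for u i
    using bij_betw_apply[OF bij, of "(u, i)"] that by auto
  have range: "snd (f (u, i)) = 0 \<or> snd (f (u, i)) = 1" if "u \<in> pverts \<Gamma>" "i = 0 \<or> i = 1" for u i
    using mem[OF that] by auto
  have edge: "e1 v = e0 u" if "(u, v) \<in> parcs \<Gamma>" for u v
  proof -
    have "(f (u, 0), f (v, 1)) \<in> parcs (times_K2 \<Gamma>)"
      using f that arc_verts[OF that] by (simp add: graph_automorphisms_def parcs_times_K2_iff)
    then show ?thesis
      by (cases "f (u, 0)"; cases "f (v, 1)") (auto simp: e0_def e1_def parcs_times_K2_iff)
  qed
  have "\<exists>u \<in> pverts \<Gamma>. e0 u = e1 u"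
  proof (rule ccontr)
    assume neq: "\<not> ?thesis"
    define X where "X = {u \<in> pverts \<Gamma>. e0 u = 0}"
    define Y where "Y = {u \<in> pverts \<Gamma>. e0 u = 1}"
    have cover: "X \<union> Y = pverts \<Gamma>" using range by (auto simp: X_def Y_def e0_def)
    have disj: "X \<inter> Y = {}" by (auto simp: X_def Y_def)
    have "u \<in> X \<and> v \<in> Y \<or> u \<in> Y \<and> v \<in> X" if uv: "(u, v) \<in> parcs \<Gamma>" for u v
    proof -
      have "u \<in> pverts \<Gamma>" "v \<in> pverts \<Gamma>" using arc_verts[OF uv] by simp_all
      moreover have "e0 v \<noteq> e0 u" using neq edge[OF arc_sym[OF uv]] arc_verts[OF uv] by auto
      ultimately show ?thesis using range[of u 0] range[of v 0] by (auto simp: X_def Y_def e0_def)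
    qed
    then have "bipartite \<Gamma>" unfolding bipartite_def
      by (intro exI[of _ X] exI[of _ Y]) (use cover disj in auto)
    with nonbipartite show False ..
  qed
  then obtain u where u: "u \<in> pverts \<Gamma>" "e0 u = e1 u" by blast
  \<comment> \<open>An arc hands the pair of shifts on with its components exchanged. Once they
    agree at one vertex the exchange is invisible, and the common value spreads to all
    vertices.\<close>
  have const: "e0 v = e0 u \<and> e1 v = e0 u" if "v \<in> pverts \<Gamma>" for v
  proof (rule connected_propagate[OF u(1) that])
    show "e0 u = e0 u \<and> e1 u = e0 u" using u(2) by simp
    show "e0 y = e0 u \<and> e1 y = e0 u" if "(x, y) \<in> parcs \<Gamma>" "e0 x = e0 u \<and> e1 x = e0 u" for x y
      using edge[OF that(1)] edge[OF arc_sym[OF that(1)]] that(2) by simp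
  qed
  show ?thesis
  proof (rule that[of "e0 u"])
    show e: "e0 u = 0 \<or> e0 u = 1" using range u(1) by (simp add: e0_def)
    fix v i assume v: "v \<in> pverts \<Gamma>" and i: "i = 0 \<or> i = (1 :: nat)"
    show "snd (f (v, i)) = (i + e0 u) mod 2"
    proof (cases "i = 0")
      case True
      then show ?thesis using const[OF v] e by (auto simp: e0_def)
    next
      case False
      then have "i = 1" using i by simp
      moreover have "1 - snd (f (v, 1)) = e0 u" using const[OF v] by (simp add: e1_def)
      ultimately show ?thesis using e range[OF v, of 1] by auto
    qed
  qed
qed

text \<open>The shift is an \<open>int\<close> because it comes from
  \<open>integer_mod_group 2\<close>, whereas layers are of type \<open>nat\<close>; hence the
  conversions. The restriction to vertices gives the extensionality that \<open>Bij\<close>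
  demands.\<close>

definition layered_lift :: "('v \<Rightarrow> 'v) \<times> int \<Rightarrow> 'v \<times> nat \<Rightarrow> 'v \<times> nat" where
  "layered_lift = (\<lambda>(g, e). \<lambda>(u, i) \<in> pverts \<Gamma> \<times> {0, 1}. (g u, nat ((int i + e) mod 2)))"

lemma layered_lift_apply:
  "u \<in> pverts \<Gamma> \<Longrightarrow> i = 0 \<or> i = 1 \<Longrightarrow> layered_lift (g, e) (u, i) = (g u, nat ((int i + e) mod 2))"
  by (auto simp: layered_lift_def)

lemma layered_lift_automorphism:
  assumes g: "g \<in> graph_automorphisms \<Gamma>" and e: "e = 0 \<or> e = 1"
  shows "layered_lift (g, e) \<in> graph_automorphisms (times_K2 \<Gamma>)"
proof -
  have bg: "bij_betw g (pverts \<Gamma>) (pverts \<Gamma>)"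
    using g by (simp add: graph_automorphisms_def Bij_def)
  have "bij_betw (\<lambda>i. nat ((int i + e) mod 2)) {0, 1} {0, 1}"
    by (rule bij_betw_byWitness[where f' = "\<lambda>i. nat ((int i + e) mod 2)"]) (use e in auto)
  from bij_betw_map_prod[OF bg this]
  have "bij_betw (layered_lift (g, e)) (pverts \<Gamma> \<times> {0, 1}) (pverts \<Gamma> \<times> {0, 1})"
    by (rule bij_betw_cong[THEN iffD1, rotated]) (auto simp: layered_lift_apply)
  moreover have "layered_lift (g, e) \<in> extensional (pverts \<Gamma> \<times> {0, 1})"
    by (simp add: layered_lift_def)
  moreover have "((u, i), (v, j)) \<in> parcs (times_K2 \<Gamma>) \<longleftrightarrow>
      (layered_lift (g, e) (u, i), layered_lift (g, e) (v, j)) \<in> parcs (times_K2 \<Gamma>)"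
    if "u \<in> pverts \<Gamma>" "v \<in> pverts \<Gamma>" "i = 0 \<or> i = 1" "j = 0 \<or> j = 1" for u v i j
    using g e that by (auto simp: layered_lift_apply parcs_times_K2_iff graph_automorphisms_def)
  ultimately show ?thesis
    unfolding graph_automorphisms_def Bij_def by auto
qed

lemma carrier_Aut_Z2:
  "carrier (Aut \<Gamma> \<times>\<times> integer_mod_group 2) = graph_automorphisms \<Gamma> \<times> {0, 1}"
  by (auto simp: Aut_def DirProd_def carrier_integer_mod_group)

lemma layered_lift_hom:
  "layered_lift \<in> hom (Aut \<Gamma> \<times>\<times> integer_mod_group 2) (Aut (times_K2 \<Gamma>))"
proof (rule homI)
  fix p assume "p \<in> carrier (Aut \<Gamma> \<times>\<times> integer_mod_group 2)"
  then show "layered_lift p \<in> carrier (Aut (times_K2 \<Gamma>))"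
    unfolding carrier_Aut_Z2 by (auto simp: Aut_def layered_lift_automorphism)
next
  fix p q assume "p \<in> carrier (Aut \<Gamma> \<times>\<times> integer_mod_group 2)"
    "q \<in> carrier (Aut \<Gamma> \<times>\<times> integer_mod_group 2)"
  then obtain g e h d where p: "p = (g, e)" "g \<in> graph_automorphisms \<Gamma>" "e = 0 \<or> e = 1"
    and q: "q = (h, d)" "h \<in> graph_automorphisms \<Gamma>" "d = 0 \<or> d = 1"
    unfolding carrier_Aut_Z2 by auto
  have gh: "g \<in> Bij (pverts \<Gamma>)" "h \<in> Bij (pverts \<Gamma>)"
    using p q by (simp_all add: graph_automorphisms_def)
  have lifts: "layered_lift p \<in> Bij (pverts \<Gamma> \<times> {0, 1})" "layered_lift q \<in> Bij (pverts \<Gamma> \<times> {0, 1})"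
    using layered_lift_automorphism[OF p(2,3)] layered_lift_automorphism[OF q(2,3)] p(1) q(1)
    by (simp_all add: graph_automorphisms_def)
  have pq: "p \<otimes>\<^bsub>Aut \<Gamma> \<times>\<times> integer_mod_group 2\<^esub> q = (compose (pverts \<Gamma>) g h, (e + d) mod 2)"
    using gh by (simp add: p q Aut_def BijGroup_def)
  have "layered_lift (compose (pverts \<Gamma>) g h, (e + d) mod 2) =
      compose (pverts \<Gamma> \<times> {0, 1}) (layered_lift (g, e)) (layered_lift (h, d))"
  proof (rule extensionalityI[of _ "pverts \<Gamma> \<times> {0, 1}"])
    fix x assume "x \<in> pverts \<Gamma> \<times> {0, 1 :: nat}"
    then obtain u i where x: "x = (u, i)" "u \<in> pverts \<Gamma>" "i = 0 \<or> i = 1" by auto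
    moreover have "h u \<in> pverts \<Gamma>" using Bij_imp_funcset[OF gh(2)] x by auto
    ultimately show "layered_lift (compose (pverts \<Gamma>) g h, (e + d) mod 2) x =
        compose (pverts \<Gamma> \<times> {0, 1}) (layered_lift (g, e)) (layered_lift (h, d)) x"
      using p(3) q(3) by (auto simp: layered_lift_apply compose_eq)
  qed (simp_all add: layered_lift_def)
  then show "layered_lift (p \<otimes>\<^bsub>Aut \<Gamma> \<times>\<times> integer_mod_group 2\<^esub> q) =
      layered_lift p \<otimes>\<^bsub>Aut (times_K2 \<Gamma>)\<^esub> layered_lift q"
    unfolding pq using lifts by (simp add: Aut_def BijGroup_def p(1) q(1))
qed

text \<open>The shift is read off from the layer of the image of \<open>(u, 0)\<close>, which
  requires a vertex \<open>u\<close> to exist; connectedness provides one.\<close>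

lemma inj_on_layered_lift: "inj_on layered_lift (graph_automorphisms \<Gamma> \<times> {0, 1})"
proof (rule inj_onI)
  fix p q assume "p \<in> graph_automorphisms \<Gamma> \<times> {0, 1 :: int}" "q \<in> graph_automorphisms \<Gamma> \<times> {0, 1 :: int}"
    and eq: "layered_lift p = layered_lift q"
  then obtain g e h d where p: "p = (g, e)" "g \<in> graph_automorphisms \<Gamma>" "e = 0 \<or> e = 1"
    and q: "q = (h, d)" "h \<in> graph_automorphisms \<Gamma>" "d = 0 \<or> d = 1"
    by auto
  have at: "g u = h u \<and> nat (e mod 2) = nat (d mod 2)" if "u \<in> pverts \<Gamma>" for u
    using fun_cong[OF eq, of "(u, 0)"] that by (simp add: p(1) q(1) layered_lift_apply)
  have "g = h"
    by (rule extensionalityI[of _ "pverts \<Gamma>"])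
       (use p q at in \<open>auto simp: graph_automorphisms_def Bij_imp_extensional\<close>)
  moreover have "e = d" using at pverts_nonempty p(3) q(3) by auto
  ultimately show "p = q" by (simp add: p q)
qed

text \<open>The second coordinate of \<open>f\<close> is a uniform shift by
  \<open>automorphism_times_K2_layers\<close>, and by hypothesis the first does not depend on the
  layer. So \<open>f\<close> splits as a map \<open>g\<close> on vertices together with a
  shift.\<close>

lemma layered_lift_surj:
  assumes f: "f \<in> graph_automorphisms (times_K2 \<Gamma>)"
    and comm: "\<And>u. u \<in> pverts \<Gamma> \<Longrightarrow> fst (f (u, 1)) = fst (f (u, 0))"
  shows "f \<in> layered_lift ` (graph_automorphisms \<Gamma> \<times> {0, 1})"
proof -
  obtain e where e: "e = 0 \<or> e = 1"
    and layer: "\<And>u i. u \<in> pverts \<Gamma> \<Longrightarrow> i = 0 \<or> i = 1 \<Longrightarrow> snd (f (u, i)) = (i + e) mod 2"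
    using automorphism_times_K2_layers[OF f] by blast
  define g where "g = (\<lambda>u \<in> pverts \<Gamma>. fst (f (u, 0)))"
  have f_eq: "f (u, i) = (g u, (i + e) mod 2)" if "u \<in> pverts \<Gamma>" "i = 0 \<or> i = 1" for u i
    using that layer[OF that] comm by (auto simp: g_def prod_eq_iff)
  have bij: "bij_betw f (pverts \<Gamma> \<times> {0, 1}) (pverts \<Gamma> \<times> {0, 1})"
    and ext: "f \<in> extensional (pverts \<Gamma> \<times> {0, 1})"
    using f by (simp_all add: graph_automorphisms_def Bij_def)
  have "g u \<in> pverts \<Gamma>" if "u \<in> pverts \<Gamma>" for u
    using bij_betw_apply[OF bij, of "(u, 0)"] that f_eq by auto
  moreover have "inj_on g (pverts \<Gamma>)"
  proof (rule inj_onI)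
    fix u v assume "u \<in> pverts \<Gamma>" "v \<in> pverts \<Gamma>" "g u = g v"
    then show "u = v"
      using inj_onD[OF bij_betw_imp_inj_on[OF bij], of "(u, 0)" "(v, 0)"] by (simp add: f_eq)
  qed
  ultimately have "bij_betw g (pverts \<Gamma>) (pverts \<Gamma>)"
    using finite_verts by (simp add: bij_betw_def endo_inj_surj image_subsetI)
  moreover have "(u, v) \<in> parcs \<Gamma> \<longleftrightarrow> (g u, g v) \<in> parcs \<Gamma>"
    if uv: "u \<in> pverts \<Gamma>" "v \<in> pverts \<Gamma>" for u v
  proof -
    \<comment> \<open>An arc between the layers remembers the underlying arc, also when
      \<open>f\<close> swaps the layers.\<close>
    have "(u, v) \<in> parcs \<Gamma> \<longleftrightarrow> ((u, 0), (v, 1)) \<in> parcs (times_K2 \<Gamma>)"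
      by (simp add: parcs_times_K2_iff)
    also have "\<dots> \<longleftrightarrow> (f (u, 0), f (v, 1)) \<in> parcs (times_K2 \<Gamma>)"
      using f uv by (simp add: graph_automorphisms_def)
    also have "\<dots> \<longleftrightarrow> (g u, g v) \<in> parcs \<Gamma>"
      using uv e by (auto simp: f_eq parcs_times_K2_iff)
    finally show ?thesis .
  qed
  ultimately have "g \<in> graph_automorphisms \<Gamma>"
    by (simp add: graph_automorphisms_def Bij_def g_def)
  moreover have "f = layered_lift (g, int e)"
  proof (rule extensionalityI[OF ext])
    fix x assume "x \<in> pverts \<Gamma> \<times> {0, 1 :: nat}"
    then show "f x = layered_lift (g, int e) x"
      using e by (auto simp: f_eq layered_lift_apply)
  qed (simp add: layered_lift_def)
  ultimately show ?thesis using e by force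
qed

text \<open>\<open>stable\<close> asserts only some abstract isomorphism. It still yields equal
  cardinalities, and as the lifts form a subset of that size in a finite set, they exhaust all
  automorphisms. Conversely, if every automorphism acts alike on both layers,
  \<open>layered_lift\<close> is itself an isomorphism.\<close>

lemma stable_iff:
  "stable \<Gamma> \<longleftrightarrow>
    (\<forall>f \<in> graph_automorphisms (times_K2 \<Gamma>). \<forall>u \<in> pverts \<Gamma>. fst (f (u, 1)) = fst (f (u, 0)))"
proof
  let ?L = "graph_automorphisms \<Gamma> \<times> {0, 1 :: int}" and ?A = "graph_automorphisms (times_K2 \<Gamma>)"
  have carrier_A: "carrier (Aut (times_K2 \<Gamma>)) = ?A" by (simp add: Aut_def)
  have sub: "layered_lift ` ?L \<subseteq> ?A" by (auto simp: layered_lift_automorphism)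
  have fin: "finite ?A" using finite_verts by (simp add: finite_graph_automorphisms)
  {
    assume "stable \<Gamma>"
    then have "card ?A = card ?L"
      unfolding stable_def using iso_same_card carrier_A carrier_Aut_Z2 by metis
    then have "layered_lift ` ?L = ?A"
      using card_subset_eq[OF fin sub] card_image[OF inj_on_layered_lift] by simp
    moreover have "\<forall>f \<in> layered_lift ` ?L. \<forall>u \<in> pverts \<Gamma>. fst (f (u, 1)) = fst (f (u, 0))"
      by (auto simp: layered_lift_apply)
    ultimately show "\<forall>f \<in> ?A. \<forall>u \<in> pverts \<Gamma>. fst (f (u, 1)) = fst (f (u, 0))" by simp
  next
    assume "\<forall>f \<in> ?A. \<forall>u \<in> pverts \<Gamma>. fst (f (u, 1)) = fst (f (u, 0))"
    then have "layered_lift ` ?L = ?A" using sub layered_lift_surj by blast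
    then have "layered_lift \<in> Group.iso (Aut \<Gamma> \<times>\<times> integer_mod_group 2) (Aut (times_K2 \<Gamma>))"
      unfolding iso_iff carrier_A carrier_Aut_Z2 using layered_lift_hom inj_on_layered_lift by blast
    then have "Aut \<Gamma> \<times>\<times> integer_mod_group 2 \<cong> Aut (times_K2 \<Gamma>)" by (rule is_isoI)
    then show "stable \<Gamma>"
      unfolding stable_def by (rule group.iso_sym[OF DirProd_group[OF group_Aut group_integer_mod_group]])
  }
qed

end

subsection \<open>Stability and Schurian S-rings\<close>

theorem theorem1p1:
  fixes H :: "('a, 'm) monoid_scheme" and A :: "('b, 'n) monoid_scheme"
    and a :: 'b and G :: "('a \<times> 'b) monoid" and S :: "'a set"
  assumes "group H" and "finite (carrier H)"
    and "group A" and "a \<in> carrier A" and "carrier A = generate A {a}"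
    and "A \<cong> integer_mod_group 2"
    and G_def: "G = H \<times>\<times> A"
    and "cayley_connection_set H S"
    and "Digraph_Component.connected (with_proj (cayley_graph H S))"
    and "\<not> bipartite (cayley_graph H S)"
  shows "\<not> stable (cayley_graph H S) \<longleftrightarrow>
    (\<exists>\<A>. S_ring G \<A> \<and> Schurian G \<A> \<and>
       set_sum (carrier H \<times> {\<one>\<^bsub>A\<^esub>}) \<in> \<A> \<and>
       set_sum ((S \<times> {\<one>\<^bsub>A\<^esub>}) #>\<^bsub>G\<^esub> (\<one>\<^bsub>H\<^esub>, a)) \<in> \<A> \<and>
       set_sum {(\<one>\<^bsub>H\<^esub>, a)} \<notin> \<A>)"
proof -
  interpret H: group H by fact
  interpret A: group A by fact
  interpret G: group G unfolding G_def by (rule DirProd_group) fact+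
  let ?\<Gamma> = "cayley_graph H S"
  interpret \<Gamma>: connected_nonbipartite_graph ?\<Gamma>
    using pair_graph_cayley_graph[OF assms(1,2,8)] assms(9,10)
    by (simp add: connected_nonbipartite_graph_def connected_nonbipartite_graph_axioms_def)
  have S: "S \<subseteq> carrier H" using assms(8) by (simp add: cayley_connection_set_def)

  \<comment> \<open>The factor of order two and the three Cayley graphs on \<open>G\<close>\<close>
  have "card (carrier A) = 2"
    using iso_same_card[OF assms(6)] by (simp add: carrier_integer_mod_group)
  \<comment> \<open>The identity generates only the trivial group, which has one element instead of
    two.\<close>
  moreover have "a \<noteq> \<one>\<^bsub>A\<^esub>"
    using calculation assms(5) A.generate_one by auto
  ultimately have carrier_A: "carrier A = {\<one>\<^bsub>A\<^esub>, a}"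
    using assms(4) by (intro card_seteq[symmetric] card_ge_0_finite) auto
  have a_neq: "a \<noteq> \<one>\<^bsub>A\<^esub>" by fact
  have aa: "a \<otimes>\<^bsub>A\<^esub> a = \<one>\<^bsub>A\<^esub>"
    using A.m_closed[OF assms(4,4)] A.l_cancel_one[OF assms(4,4)] a_neq carrier_A by auto
  have inv_a: "inv\<^bsub>A\<^esub> a = a" using A.inv_equality[OF aa assms(4,4)] .
  have carrier_G: "carrier G = carrier H \<times> {\<one>\<^bsub>A\<^esub>, a}" by (simp add: G_def carrier_A)
  have finite_G: "finite (carrier G)" using assms(2) by (simp add: carrier_G)

  let ?T = "(S \<times> {\<one>\<^bsub>A\<^esub>}) #>\<^bsub>G\<^esub> (\<one>\<^bsub>H\<^esub>, a)"
  have T: "?T = S \<times> {a}" using S assms(4) by (force simp: r_coset_def G_def)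
  have subs: "?T \<subseteq> carrier G" "carrier H \<times> {\<one>\<^bsub>A\<^esub>} \<subseteq> carrier G" "{(\<one>\<^bsub>H\<^esub>, a)} \<subseteq> carrier G"
    using S unfolding T carrier_G by auto
  note arc = parcs_cayley_graph_iff[OF G.is_group]
  have diff: "(y, t') \<otimes>\<^bsub>G\<^esub> inv\<^bsub>G\<^esub> (x, t) = (y \<otimes>\<^bsub>H\<^esub> inv\<^bsub>H\<^esub> x, t' \<otimes>\<^bsub>A\<^esub> inv\<^bsub>A\<^esub> t)"
    if "x \<in> carrier H" "t \<in> carrier A" for x y t t'
    using that assms(1,3) by (simp add: G_def inv_DirProd)
  \<comment> \<open>The quotient in \<open>A\<close> is the identity or \<open>a\<close> according
    to whether the second coordinates agree. The graph for \<open>H\<close> therefore encodes the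
    relation of lying in the same layer, and the graph for \<open>a\<close> matches the two copies
    of each vertex.\<close>
  have arc_T: "((x, t), (y, t')) \<in> parcs (cayley_graph G ?T) \<longleftrightarrow> (x, y) \<in> parcs ?\<Gamma> \<and> t \<noteq> t'"
    and arc_H: "((x, t), (y, t')) \<in> parcs (cayley_graph G (carrier H \<times> {\<one>\<^bsub>A\<^esub>})) \<longleftrightarrow> t = t'"
    and arc_a: "((x, t), (y, t')) \<in> parcs (cayley_graph G {(\<one>\<^bsub>H\<^esub>, a)}) \<longleftrightarrow> x = y \<and> t \<noteq> t'"
    if xy: "x \<in> carrier H" "y \<in> carrier H" and t: "t = \<one>\<^bsub>A\<^esub> \<or> t = a" "t' = \<one>\<^bsub>A\<^esub> \<or> t' = a"
    for x y t t'
  proof -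
    have mem: "(x, t) \<in> carrier G" "(y, t') \<in> carrier G" "t \<in> carrier A"
      using xy t by (auto simp: carrier_G carrier_A)
    have tt: "t' \<otimes>\<^bsub>A\<^esub> inv\<^bsub>A\<^esub> t = (if t = t' then \<one>\<^bsub>A\<^esub> else a)"
      using t assms(4) by (auto simp: inv_a aa)
    have "y \<otimes>\<^bsub>H\<^esub> inv\<^bsub>H\<^esub> x = \<one>\<^bsub>H\<^esub> \<longleftrightarrow> x = y"
      using xy by (metis H.inv_closed H.inv_equality H.inv_inv H.r_inv)
    then show "((x, t), (y, t')) \<in> parcs (cayley_graph G ?T) \<longleftrightarrow> (x, y) \<in> parcs ?\<Gamma> \<and> t \<noteq> t'"
      "((x, t), (y, t')) \<in> parcs (cayley_graph G (carrier H \<times> {\<one>\<^bsub>A\<^esub>})) \<longleftrightarrow> t = t'"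
      "((x, t), (y, t')) \<in> parcs (cayley_graph G {(\<one>\<^bsub>H\<^esub>, a)}) \<longleftrightarrow> x = y \<and> t \<noteq> t'"
      using xy a_neq subs mem
      by (auto simp: arc[OF subs(1)[unfolded T]] arc[OF subs(2)] arc[OF subs(3)] diff tt T
          parcs_cayley_graph_iff[OF assms(1) S])
  qed

  \<comment> \<open>Identification of \<open>Cay(G, Sa)\<close> with the direct product, and its
    layers\<close>
  define \<phi> :: "'a \<times> 'b \<Rightarrow> 'a \<times> nat" where "\<phi> = map_prod id (\<lambda>t. if t = a then 1 else 0)"
  \<comment> \<open>The \<open>else\<close> branch also catches numbers that are not layers; on
    vertices only 0 reaches it, and there \<open>\<phi>\<close> and \<open>\<psi>\<close> are
    mutually inverse.\<close>
  define \<psi> :: "'a \<times> nat \<Rightarrow> 'a \<times> 'b" where "\<psi> = map_prod id (\<lambda>i. if i = 1 then a else \<one>\<^bsub>A\<^esub>)"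
  have \<phi>: "\<phi> (x, \<one>\<^bsub>A\<^esub>) = (x, 0)" "\<phi> (x, a) = (x, 1)" for x
    using a_neq by (auto simp: \<phi>_def)
  have \<psi>: "\<psi> (x, 0) = (x, \<one>\<^bsub>A\<^esub>)" "\<psi> (x, 1) = (x, a)" for x
    by (auto simp: \<psi>_def)
  have fst_eq: "fst (\<phi> p) = fst p" "fst (\<psi> q) = fst q" for p q
    by (simp_all add: \<phi>_def \<psi>_def)
  have bij_\<phi>: "bij_betw \<phi> (pverts (cayley_graph G ?T)) (pverts (times_K2 ?\<Gamma>))"
    by (rule bij_betw_byWitness[where f' = \<psi>]) (auto simp: carrier_G \<phi>_def \<psi>_def a_neq[symmetric])
  have bij_\<psi>: "bij_betw \<psi> (pverts (times_K2 ?\<Gamma>)) (pverts (cayley_graph G ?T))"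
    by (rule bij_betw_byWitness[where f' = \<phi>]) (auto simp: carrier_G \<phi>_def \<psi>_def a_neq[symmetric])
  have arcs_\<phi>: "(p, q) \<in> parcs (cayley_graph G ?T) \<longleftrightarrow> (\<phi> p, \<phi> q) \<in> parcs (times_K2 ?\<Gamma>)"
    if "p \<in> pverts (cayley_graph G ?T)" "q \<in> pverts (cayley_graph G ?T)" for p q
    using that a_neq by (auto simp: carrier_G \<phi> arc_T \<Gamma>.parcs_times_K2_iff)
  have arcs_\<psi>: "(p, q) \<in> parcs (times_K2 ?\<Gamma>) \<longleftrightarrow> (\<psi> p, \<psi> q) \<in> parcs (cayley_graph G ?T)"
    if "p \<in> pverts (times_K2 ?\<Gamma>)" "q \<in> pverts (times_K2 ?\<Gamma>)" for p q
    using that a_neq by (auto simp: \<psi>[simplified] arc_T \<Gamma>.parcs_times_K2_iff)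

  \<comment> \<open>By \<open>set_sum_in_transitivity_module_iff\<close> this is the largest
    permutation group over the right translations whose module contains the sum of
    \<open>Sa\<close>, so it serves as the witness in the unstable case.\<close>
  let ?B = "graph_automorphisms (cayley_graph G ?T)"
  have B_Bij: "b \<in> Bij (carrier G)" if "b \<in> ?B" for b
    using that by (simp add: graph_automorphisms_def)
  have B_closed: "b p \<in> carrier G" if "b \<in> ?B" "p \<in> carrier G" for b p
    using Bij_imp_funcset[OF B_Bij[OF that(1)]] that(2) by auto
  \<comment> \<open>Carried over to the direct product, \<open>b\<close> shifts all layers by one
    common \<open>e\<close>, so it cannot separate or merge layers. Connectedness and
    non-bipartiteness enter here.\<close>
  have layers: "snd (b p) = snd (b q) \<longleftrightarrow> snd p = snd q"
    if b: "b \<in> ?B" and pq: "p \<in> carrier G" "q \<in> carrier G" for b p q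
  proof -
    obtain f where f: "f \<in> graph_automorphisms (times_K2 ?\<Gamma>)"
      and fb: "\<And>p. p \<in> pverts (cayley_graph G ?T) \<Longrightarrow> f (\<phi> p) = \<phi> (b p)"
      using graph_automorphism_transport[OF bij_\<phi> arcs_\<phi> b] by blast
    obtain e where e: "e = 0 \<or> e = 1"
      and layer: "\<And>u i. u \<in> pverts ?\<Gamma> \<Longrightarrow> i = 0 \<or> i = 1 \<Longrightarrow> snd (f (u, i)) = (i + e) mod 2"
      using \<Gamma>.automorphism_times_K2_layers[OF f] by blast
    have shift: "snd (\<phi> (b p)) = (snd (\<phi> p) + e) mod 2" if "p \<in> carrier G" for p
      using fb[of p] layer[of "fst p" "snd (\<phi> p)"] that by (auto simp: carrier_G \<phi>)
    have snd_\<phi>: "snd (\<phi> p) = snd (\<phi> q) \<longleftrightarrow> snd p = snd q" if "p \<in> carrier G" "q \<in> carrier G" for p q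
      using that a_neq by (auto simp: carrier_G \<phi>)
    have "(snd (\<phi> p) + e) mod 2 = (snd (\<phi> q) + e) mod 2 \<longleftrightarrow> snd (\<phi> p) = snd (\<phi> q)"
      using e by (auto simp: \<phi>_def)
    then show ?thesis
      using shift pq by (simp flip: snd_\<phi>[OF B_closed[OF b pq(1)] B_closed[OF b pq(2)]] snd_\<phi>[OF pq])
  qed
  have B_H: "?B \<subseteq> graph_automorphisms (cayley_graph G (carrier H \<times> {\<one>\<^bsub>A\<^esub>}))"
  proof
    fix b assume b: "b \<in> ?B"
    have arc_H': "(p, q) \<in> parcs (cayley_graph G (carrier H \<times> {\<one>\<^bsub>A\<^esub>})) \<longleftrightarrow> snd p = snd q"
      if "p \<in> carrier G" "q \<in> carrier G" for p q
      using that by (auto simp: carrier_G arc_H)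
    show "b \<in> graph_automorphisms (cayley_graph G (carrier H \<times> {\<one>\<^bsub>A\<^esub>}))"
      using b by (simp add: graph_automorphisms_def[of "cayley_graph G (carrier H \<times> {\<one>\<^bsub>A\<^esub>})"]
          B_Bij arc_H' B_closed layers)
  qed

  \<comment> \<open>Stability as a containment of automorphism groups\<close>
  have stable_iff: "stable ?\<Gamma> \<longleftrightarrow> ?B \<subseteq> graph_automorphisms (cayley_graph G {(\<one>\<^bsub>H\<^esub>, a)})"
  proof
    assume st: "stable ?\<Gamma>"
    show "?B \<subseteq> graph_automorphisms (cayley_graph G {(\<one>\<^bsub>H\<^esub>, a)})"
    proof
      fix b assume b: "b \<in> ?B"
      obtain f where f: "f \<in> graph_automorphisms (times_K2 ?\<Gamma>)"
        and fb: "\<And>p. p \<in> pverts (cayley_graph G ?T) \<Longrightarrow> f (\<phi> p) = \<phi> (b p)"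
        using graph_automorphism_transport[OF bij_\<phi> arcs_\<phi> b] by blast
      have "fst (b (x, a)) = fst (b (x, \<one>\<^bsub>A\<^esub>))" if "x \<in> carrier H" for x
      proof -
        have "fst (f (x, 1)) = fst (f (x, 0))" using st f that by (simp add: \<Gamma>.stable_iff)
        then show ?thesis
          using fb[of "(x, a)"] fb[of "(x, \<one>\<^bsub>A\<^esub>)"] that by (simp add: \<phi> carrier_G fst_eq)
      qed
      then have fst_const: "fst (b p) = fst (b q)"
        if "p \<in> carrier G" "q \<in> carrier G" "fst p = fst q" for p q
        using that by (auto simp: carrier_G)
      have inj: "b p = b q \<longleftrightarrow> p = q" if "p \<in> carrier G" "q \<in> carrier G" for p q
        using B_Bij[OF b] that by (auto simp: Bij_def bij_betw_def inj_on_eq_iff)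
      have arc_a': "(p, q) \<in> parcs (cayley_graph G {(\<one>\<^bsub>H\<^esub>, a)}) \<longleftrightarrow> fst p = fst q \<and> snd p \<noteq> snd q"
        if "p \<in> carrier G" "q \<in> carrier G" for p q
        using that by (auto simp: carrier_G arc_a)
      have "fst p = fst q \<and> snd p \<noteq> snd q \<longleftrightarrow> fst (b p) = fst (b q) \<and> snd (b p) \<noteq> snd (b q)"
        if pq: "p \<in> carrier G" "q \<in> carrier G" for p q
      proof
        assume "fst p = fst q \<and> snd p \<noteq> snd q"
        then show "fst (b p) = fst (b q) \<and> snd (b p) \<noteq> snd (b q)"
          using fst_const[OF pq] layers[OF b pq] by simp
      next
        assume R: "fst (b p) = fst (b q) \<and> snd (b p) \<noteq> snd (b q)"
        \<comment> \<open>The auxiliary point shares its first coordinate with \<open>p\<close> and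
          its layer with \<open>q\<close>. Its image therefore agrees with \<open>b q\<close> in
          both coordinates, and injectivity identifies it with \<open>q\<close>.\<close>
        have r: "(fst p, snd q) \<in> carrier G" using pq by (auto simp: carrier_G)
        have "b (fst p, snd q) = b q"
          using R fst_const[OF r pq(1)] layers[OF b r pq(2)] by (simp add: prod_eq_iff)
        then have "(fst p, snd q) = q" using inj[OF r pq(2)] by simp
        then have "fst p = fst q" by (metis fst_conv)
        then show "fst p = fst q \<and> snd p \<noteq> snd q"
          using R layers[OF b pq] by simp
      qed
      then show "b \<in> graph_automorphisms (cayley_graph G {(\<one>\<^bsub>H\<^esub>, a)})"
        using b by (simp add: graph_automorphisms_def[of "cayley_graph G {(\<one>\<^bsub>H\<^esub>, a)}"]
            B_Bij arc_a' B_closed)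
    qed
  next
    assume sub: "?B \<subseteq> graph_automorphisms (cayley_graph G {(\<one>\<^bsub>H\<^esub>, a)})"
    show "stable ?\<Gamma>"
      unfolding \<Gamma>.stable_iff
    proof (intro ballI)
      fix f x assume f: "f \<in> graph_automorphisms (times_K2 ?\<Gamma>)" and "x \<in> pverts ?\<Gamma>"
      then have x: "x \<in> carrier H" by simp
      obtain b where b: "b \<in> ?B"
        and bf: "\<And>p. p \<in> pverts (times_K2 ?\<Gamma>) \<Longrightarrow> b (\<psi> p) = \<psi> (f p)"
        using graph_automorphism_transport[OF bij_\<psi> arcs_\<psi> f] by blast
      have mem: "(x, \<one>\<^bsub>A\<^esub>) \<in> carrier G" "(x, a) \<in> carrier G" using x by (auto simp: carrier_G)
      \<comment> \<open>The two copies of \<open>x\<close> are joined in the graph for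
        \<open>a\<close>, so their images under \<open>b\<close> must again be two copies of one
        vertex.\<close>
      have "((x, \<one>\<^bsub>A\<^esub>), (x, a)) \<in> parcs (cayley_graph G {(\<one>\<^bsub>H\<^esub>, a)})"
        using x a_neq by (auto simp: arc_a)
      then have "(b (x, \<one>\<^bsub>A\<^esub>), b (x, a)) \<in> parcs (cayley_graph G {(\<one>\<^bsub>H\<^esub>, a)})"
        using sub b mem by (auto simp: graph_automorphisms_def)
      then have "fst (b (x, \<one>\<^bsub>A\<^esub>)) = fst (b (x, a))"
        using B_closed[OF b mem(1)] B_closed[OF b mem(2)] by (auto simp: carrier_G arc_a)
      then show "fst (f (x, 1)) = fst (f (x, 0))"
        using bf[of "(x, 0)"] bf[of "(x, 1)"] x by (simp add: \<psi>[simplified] fst_eq)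
    qed
  qed

  \<comment> \<open>The equivalence with the existence of a Schurian S-ring\<close>
  have overgroup: "translation_overgroup G B \<longleftrightarrow>
      subgroup B (BijGroup (carrier G)) \<and> right_translations G \<subseteq> B" for B
    using finite_G G.is_group
    by (simp add: translation_overgroup_def translation_overgroup_axioms_def)
  show ?thesis
  proof
    assume "\<not> stable ?\<Gamma>"
    interpret translation_overgroup G ?B
      unfolding overgroup
      using subgroup_graph_automorphisms[of "cayley_graph G ?T"]
        right_translations_subset_graph_automorphisms[OF G.is_group subs(1)] by simp
    show "\<exists>\<A>. S_ring G \<A> \<and> Schurian G \<A> \<and> set_sum (carrier H \<times> {\<one>\<^bsub>A\<^esub>}) \<in> \<A> \<and>
        set_sum ?T \<in> \<A> \<and> set_sum {(\<one>\<^bsub>H\<^esub>, a)} \<notin> \<A>"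
    proof (intro exI conjI)
      show "S_ring G transitivity_module" by (rule S_ring_transitivity_module)
      show "Schurian G transitivity_module" by (rule Schurian_transitivity_module)
      show "set_sum (carrier H \<times> {\<one>\<^bsub>A\<^esub>}) \<in> transitivity_module"
        unfolding set_sum_in_transitivity_module_iff[OF subs(2)] by (rule B_H)
      show "set_sum ?T \<in> transitivity_module"
        unfolding set_sum_in_transitivity_module_iff[OF subs(1)] ..
      show "set_sum {(\<one>\<^bsub>H\<^esub>, a)} \<notin> transitivity_module"
        unfolding set_sum_in_transitivity_module_iff[OF subs(3)] stable_iff[symmetric] by fact
    qed
  next
    assume "\<exists>\<A>. S_ring G \<A> \<and> Schurian G \<A> \<and> set_sum (carrier H \<times> {\<one>\<^bsub>A\<^esub>}) \<in> \<A> \<and>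
        set_sum ?T \<in> \<A> \<and> set_sum {(\<one>\<^bsub>H\<^esub>, a)} \<notin> \<A>"
    then obtain B where B: "subgroup B (BijGroup (carrier G))" "right_translations G \<subseteq> B"
      and mem: "set_sum ?T \<in> int_span (set_sum ` stabilizer_orbits G B)"
        "set_sum {(\<one>\<^bsub>H\<^esub>, a)} \<notin> int_span (set_sum ` stabilizer_orbits G B)"
      unfolding Schurian_def by blast
    interpret translation_overgroup G B unfolding overgroup using B by blast
    \<comment> \<open>The group \<open>B\<close> lies in \<open>?B\<close> but not in the
      automorphism group of the graph for \<open>a\<close>, so \<open>?B\<close> is not contained in
      the latter either.\<close>
    show "\<not> stable ?\<Gamma>"
      using mem set_sum_in_transitivity_module_iff[OF subs(1)]
        set_sum_in_transitivity_module_iff[OF subs(3)] stable_iff by blast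
  qed
qed

end
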